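(* Let $\mathcal{A}\subset\mathbb{Z}_{\ge0}^n$ be the $GT$-subset associated to a linear system of congruences $(M,d_1,\ldots,d_s)$. Then $n_0(\mathcal{A})\le n+1$.
   Context: Let $n,d_1,\ldots,d_s\ge1$ be integers and let $M=(a_{i,j})$ be an $s\times(n+1)$ matrix of integers ($1\le i\le s$, $0\le j\le n$) with $0\le a_{i,0},\ldots,a_{i,n}<d_i$ and $\gcd(a_{i,0},\ldots,a_{i,n},d_i)=1$ for each $i$. Put $d=d_1\cdots d_s$. The linear system of congruences $(M,d_1,\ldots,d_s)$ consists of $y_0+y_1+\cdots+y_n\equiv0\pmod d$ and $a_{i,0}y_0+\cdots+a_{i,n}y_n\equiv0\pmod{d_i}$ for $1\le i\le s$. For $t\ge1$, $(M,d_1,\ldots,d_s;t)$ denotes the system in which the first congruence is replaced by the equation $y_0+\cdots+y_n=td$. Let $\overline{\mathcal{A}}\subset\mathbb{Z}_{\ge0}^{n+1}$ be the finite set of $\mathbb{Z}_{\ge0}^{n+1}$-solutions of $(M,d_1,\ldots,d_s;1)$. The $GT$-subset associated to $(M,d_1,\ldots,d_s)$ is $\mathcal{A}=\{(a_1,\ldots,a_n)\mid(a_0,a_1,\ldots,a_n)\in\overline{\mathcal{A}}\}\subset\mathbb{Z}_{\ge0}^n$. For $t\ge1$, $t\mathcal{A}$ is the set of sums of $t$ (not necessarily distinct) elements of $\mathcal{A}$, $0\mathcal{A}=\{0\}$, and $\varphi_{\mathcal{A}}(t)=|t\mathcal{A}|$. There is a polynomial $p_{\mathcal{A}}\in\mathbb{Q}[t]$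 with $\varphi_{\mathcal{A}}(t)=p_{\mathcal{A}}(t)$ for $t\gg0$ (Khovanskii), and the phase transition is $n_0(\mathcal{A})=\min\{n_0\in\mathbb{Z}_{\ge0}\mid\varphi_{\mathcal{A}}(t)=p_{\mathcal{A}}(t)\ \forall t\ge n_0\}$. *)

theory Defs
  imports
    "HOL-Number_Theory.Cong"
    "HOL-Computational_Algebra.Polynomial"
    "HOL-Library.Function_Algebras"
begin

text \<open>
  The matrix is a function \<open>a i j\<close> with rows \<open>1 \<le> i \<le> s\<close> and columns \<open>0 \<le> j \<le> n\<close>; the values of
  \<open>a\<close> and \<open>d\<close> outside these ranges are irrelevant. A vector of nonnegative integers indexed
  by a finite set \<open>I\<close> of naturals is a function \<open>nat \<Rightarrow> nat\<close> that vanishes outside \<open>I\<close>, so that the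
  pointwise addition of \<open>Function_Algebras\<close> is vector addition. Points with coordinates
  \<open>0, \<dots>, n\<close> and \<open>1, \<dots>, n\<close> are supported in \<open>{0..n}\<close> and \<open>{1..n}\<close> respectively.
\<close>

definition congruence_system :: "nat \<Rightarrow> nat \<Rightarrow> (nat \<Rightarrow> nat \<Rightarrow> int) \<Rightarrow> (nat \<Rightarrow> int) \<Rightarrow> bool" where
  "congruence_system n s a d \<longleftrightarrow>
     n \<ge> 1 \<and> s \<ge> 1 \<and>
     (\<forall>i\<in>{1..s}. d i \<ge> 1 \<and> (\<forall>j\<in>{0..n}. 0 \<le> a i j \<and> a i j < d i) \<and>
                 Gcd (insert (d i) (a i ` {0..n})) = 1)"

definition system_solutions ::
  "nat \<Rightarrow> nat \<Rightarrow> (nat \<Rightarrow> nat \<Rightarrow> int) \<Rightarrow> (nat \<Rightarrow> int) \<Rightarrow> nat \<Rightarrow> (nat \<Rightarrow> nat) set" where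
  "system_solutions n s a d t =
     {y. (\<forall>j. j \<notin> {0..n} \<longrightarrow> y j = 0) \<and>
         (\<Sum>j\<in>{0..n}. int (y j)) = int t * (\<Prod>i\<in>{1..s}. d i) \<and>
         (\<forall>i\<in>{1..s}. [(\<Sum>j\<in>{0..n}. a i j * int (y j)) = 0] (mod d i))}"

text \<open>Resetting coordinate \<open>0\<close> to zero is the projection \<open>(a\<^sub>0, a\<^sub>1, \<dots>, a\<^sub>n) \<mapsto> (a\<^sub>1, \<dots>, a\<^sub>n)\<close>.\<close>

definition GT_subset ::
  "nat \<Rightarrow> nat \<Rightarrow> (nat \<Rightarrow> nat \<Rightarrow> int) \<Rightarrow> (nat \<Rightarrow> int) \<Rightarrow> (nat \<Rightarrow> nat) set" where
  "GT_subset n s a d = (\<lambda>y. y(0 := 0)) ` system_solutions n s a d 1"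

definition sumset :: "nat \<Rightarrow> 'a::comm_monoid_add set \<Rightarrow> 'a set" where
  "sumset t A = {\<Sum>k<t. f k | f. \<forall>k<t. f k \<in> A}"

lemma sumset_0 [simp]: "sumset 0 A = {0}"
  by (simp add: sumset_def)

definition sumset_card :: "'a::comm_monoid_add set \<Rightarrow> nat \<Rightarrow> nat" where
  "sumset_card A t = card (sumset t A)"

text \<open>
  For a finite set \<open>A\<close> of lattice points the polynomial exists by Khovanskii's theorem; it is
  unique by the lemma below.
\<close>

definition khovanskii_poly :: "'a::comm_monoid_add set \<Rightarrow> rat poly" where
  "khovanskii_poly A =
     (THE p. \<forall>\<^sub>F t in sequentially. of_nat (sumset_card A t) = poly p (of_nat t))"

definition phase_transition :: "'a::comm_monoid_add set \<Rightarrow> nat" where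
  "phase_transition A =
     (LEAST n0. \<forall>t\<ge>n0. of_nat (sumset_card A t) = poly (khovanskii_poly A) (of_nat t))"

lemma khovanskii_poly_eqI:
  assumes p: "\<forall>\<^sub>F t in sequentially. of_nat (sumset_card A t) = poly p (of_nat t)"
  shows "khovanskii_poly A = p"
  unfolding khovanskii_poly_def
proof (rule the_equality[where P = "\<lambda>p. \<forall>\<^sub>F t in sequentially. _ t = poly p (of_nat t)", OF p])
  fix q :: "rat poly"
  assume q: "\<forall>\<^sub>F t in sequentially. of_nat (sumset_card A t) = poly q (of_nat t)"
  from p q have "\<forall>\<^sub>F t in sequentially. poly (q - p) (of_nat t) = 0"
    by eventually_elim simp
  then obtain N where N: "\<And>t. t \<ge> N \<Longrightarrow> poly (q - p) (of_nat t) = 0"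
    by (auto simp: eventually_sequentially)
  have "infinite (of_nat ` {N..} :: rat set)"
    by (simp add: finite_image_iff inj_on_def infinite_Ici)
  moreover have "of_nat ` {N..} \<subseteq> {x. poly (q - p) x = 0}"
    using N by auto
  ultimately have "infinite {x. poly (q - p) x = 0}"
    using finite_subset by blast
  then show "q = p"
    using poly_roots_finite[of "q - p"] by auto
qed

end

theory Submission
  imports Defs "HOL-Number_Theory.Residues" "HOL-Library.Multiset" "HOL-Library.FuncSet"
begin

text \<open>
  The polynomial describes \<open>\<phi>\<close> at every \<open>t \<ge> 0\<close>, so the phase transition is \<open>0\<close>. Two facts
  give this. Write \<open>D = d\<^sub>1 \<cdots> d\<^sub>s\<close>, and let \<open>S t\<close> be the set of solutions with coordinate sum
  \<open>t D\<close>, so that the \<open>GT\<close>-subset is the projection of \<open>S 1\<close>.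
  
  First, every element of \<open>S t\<close> is a sum of \<open>t\<close> elements of \<open>S 1\<close>. Read a vector \<open>y\<close> as a
  multiset of columns of the matrix, in which column \<open>j\<close> occurs \<open>y j\<close> times. Then \<open>y\<close> is an
  element of \<open>S t\<close> if and only if this multiset has \<open>t D\<close> elements and sum zero in the group
  \<open>\<int>/d\<^sub>1 \<times> \<cdots> \<times> \<int>/d\<^sub>s\<close> of order \<open>D\<close>. By the theorem of Erdos, Ginzburg and Ziv, \<open>2 D - 1\<close>
  elements of a finite abelian group of order \<open>D\<close> contain \<open>D\<close> elements with sum zero. Hence an
  element of \<open>S (t + 1)\<close> with \<open>t \<ge> 1\<close> splits off an element of \<open>S 1\<close>
  (\<open>solution_splits_off_unit\<close>), and induction gives \<open>t (S 1) = S t\<close>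
  (\<open>sumset_system_solutions\<close>). The projection that forgets coordinate \<open>0\<close> is injective on \<open>S t\<close>,
  because the coordinate sum is known there; so \<open>\<phi> t = |S t|\<close> (\<open>sumset_card_GT_subset\<close>).
  
  Second, \<open>|S t|\<close> counts the points of a lattice in the \<open>t\<close>-th dilate of a simplex whose vertices
  \<open>D e\<^sub>j\<close> lie in that lattice, so it is an Ehrhart polynomial. Concretely, division with remainder
  by \<open>D\<close> writes \<open>y = r + D q\<close> with \<open>r\<close> in the half-open box \<open>[0, D)\<^sup>n\<^sup>+\<^sup>1\<close>, where \<open>r\<close> satisfies the same
  congruences as \<open>y\<close> and its coordinate sum is \<open>k D\<close> for some \<open>k \<le> n\<close>. There are
  \<open>(t - k + n) choose n\<close> vectors \<open>q\<close> for each \<open>r\<close> (\<open>card_simplex_points\<close>). As \<open>k \<le> n\<close>, this number is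
  the value at \<open>t\<close> of a polynomial for all \<open>t \<ge> 0\<close>, including \<open>t < k\<close>, where both are zero.
\<close>

section \<open>The Erdos-Ginzburg-Ziv theorem for prime order\<close>

lemma card_supersets:
  assumes "finite I" "S \<subseteq> I" "card S \<le> m"
  shows "card {J. S \<subseteq> J \<and> J \<subseteq> I \<and> card J = m} = (card I - card S) choose (m - card S)"
proof -
  have fS: "finite S" using assms finite_subset by blast
  have "bij_betw (\<lambda>J. J - S) {J. S \<subseteq> J \<and> J \<subseteq> I \<and> card J = m}
          {K. K \<subseteq> I - S \<and> card K = m - card S}"
  proof (rule bij_betw_byWitness[where f' = "\<lambda>K. K \<union> S"])
    show "(\<lambda>J. J - S) ` {J. S \<subseteq> J \<and> J \<subseteq> I \<and> card J = m} \<subseteq> {K. K \<subseteq> I - S \<and> card K = m - card S}"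
      using fS by (auto simp: card_Diff_subset)
    show "(\<lambda>K. K \<union> S) ` {K. K \<subseteq> I - S \<and> card K = m - card S} \<subseteq> {J. S \<subseteq> J \<and> J \<subseteq> I \<and> card J = m}"
    proof safe
      fix K assume K: "K \<subseteq> I - S" "card K = m - card S"
      have "finite K" using K assms(1) finite_subset by blast
      then show "card (K \<union> S) = m"
        using K fS assms(3) by (subst card_Un_disjoint) auto
    qed (use assms in auto)
  qed auto
  then have "card {J. S \<subseteq> J \<and> J \<subseteq> I \<and> card J = m} = card {K. K \<subseteq> I - S \<and> card K = m - card S}"
    by (rule bij_betw_same_card)
  also have "\<dots> = (card I - card S) choose (m - card S)"
    using n_subsets[of "I - S" "m - card S"] assms fS by (simp add: card_Diff_subset)
  finally show ?thesis .
qed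

lemma prime_dvd_choose_above:
  fixes p :: nat
  assumes "prime p" "p \<le> N" "k < p" "N - k < p" "k \<le> N"
  shows "p dvd N choose k"
proof -
  have "p dvd fact N" using assms by (simp add: prime_dvd_fact_iff)
  then have "p dvd fact k * fact (N - k) * (N choose k)"
    using binomial_fact_lemma[of k N] assms by simp
  then show ?thesis
    using assms by (auto simp: prime_dvd_mult_iff prime_dvd_fact_iff)
qed

lemma prime_not_dvd_central_choose:
  fixes p :: nat
  assumes "prime p"
  shows "\<not> p dvd (2 * p - 1) choose p"
proof
  assume "p dvd (2 * p - 1) choose p"
  have p: "p \<ge> 1" using assms prime_ge_1_nat by blast
  \<comment> \<open>Cancelling \<open>p!\<close> leaves \<open>(p + 1) \<cdots> (2 p - 1)\<close> on the right, and none of its factors is a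
    multiple of \<open>p\<close>.\<close>
  have "fact p * (fact (p - 1) * ((2 * p - 1) choose p)) = fact (2 * p - 1)"
    using binomial_fact_lemma[of p "2 * p - 1"] p by (simp add: mult.assoc)
  also have "\<dots> = fact p * \<Prod>{p + 1..2 * p - 1}"
    using fact_eq_fact_times[of p "2 * p - 1"] p by simp
  finally have "fact (p - 1) * ((2 * p - 1) choose p) = \<Prod>{p + 1..2 * p - 1}"
    by simp
  with \<open>p dvd (2 * p - 1) choose p\<close> have "p dvd \<Prod>{p + 1..2 * p - 1}"
    by (metis dvd_mult)
  then obtain m where m: "m \<in> {p + 1..2 * p - 1}" "p dvd m"
    using assms by (auto simp: prime_dvd_prod_iff)
  then have "p dvd m - p" "0 < m - p" "m - p < p" by auto
  then show False using nat_dvd_not_less by blast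
qed

lemma fermat_int:
  fixes z :: int
  assumes "prime p" "\<not> int p dvd z"
  shows "[z ^ (p - 1) = 1] (mod int p)"
proof -
  define u where "u = nat (z mod int p)"
  have p: "int p > 0" using assms(1) prime_gt_0_nat by simp
  then have u: "int u = z mod int p" by (simp add: u_def)
  then have uz: "[z = int u] (mod int p)" by (simp add: cong_def)
  then have "\<not> p dvd u"
    using assms(2) cong_dvd_iff int_dvd_int_iff  by (metis cong_dvd_modulus cong_sym dvd_refl cong_0_iff cong_trans)
  then have "[int (u ^ (p - 1)) = int 1] (mod int p)"
    using fermat_theorem[OF assms(1)] cong_int_iff by blast
  then show ?thesis
    using cong_pow[OF uz] cong_trans by (metis of_nat_1 of_nat_power)
qed

text \<open>
  Suppose that no \<open>p\<close>-element set \<open>J \<subseteq> I\<close> works. By Fermat's theorem each \<open>(\<Sum>i\<in>J. x i) ^ (p - 1)\<close>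
  is then \<open>1\<close> modulo \<open>p\<close>, so the sum of these powers over all \<open>J\<close> is congruent to
  \<open>(2 p - 1) choose p\<close>, which \<open>p\<close> does not divide. Expanding the powers instead, a monomial with
  \<open>c\<close> distinct variables, \<open>1 \<le> c \<le> p - 1\<close>, occurs once for every \<open>J\<close> that contains its variables,
  hence \<open>(2 p - 1 - c) choose (p - c)\<close> times; this is a multiple of \<open>p\<close>, a contradiction.
\<close>

lemma erdos_ginzburg_ziv_prime:
  fixes x :: "'i \<Rightarrow> int"
  assumes p: "prime p" and I: "finite I" "card I = 2 * p - 1"
  shows "\<exists>J\<subseteq>I. card J = p \<and> int p dvd sum x J"
proof (rule ccontr)
  assume neg: "\<not> ?thesis"
  have p2: "p \<ge> 2" using p prime_ge_2_nat by blast
  define F where "F = {J. J \<subseteq> I \<and> card J = p}"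
  define E where "E = (\<lambda>J. {..<p - 1} \<rightarrow>\<^sub>E J :: (nat \<Rightarrow> 'i) set)"
  have finI: "\<And>J. J \<in> F \<Longrightarrow> finite J"
    using I finite_subset unfolding F_def by blast
  have finF: "finite F" using I unfolding F_def by simp
  have finE: "finite (E I)" unfolding E_def using I by (intro finite_PiE) auto
  \<comment> \<open>A word \<open>f\<close> of length \<open>p - 1\<close> over \<open>J\<close> stands for one term in the expansion of the power.\<close>
  have "(\<Sum>J\<in>F. sum x J ^ (p - 1)) = (\<Sum>J\<in>F. \<Sum>f\<in>E J. \<Prod>i<p - 1. x (f i))"
  proof (rule sum.cong[OF refl])
    fix J assume "J \<in> F"
    then show "sum x J ^ (p - 1) = (\<Sum>f\<in>E J. \<Prod>i<p - 1. x (f i))"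
      using prod_sum_PiE[of "{..<p - 1}" "\<lambda>_. J" "\<lambda>_. x"] finI by (simp add: E_def)
  qed
  also have "\<dots> = (\<Sum>J\<in>F. \<Sum>f | f \<in> E I \<and> f ` {..<p - 1} \<subseteq> J. \<Prod>i<p - 1. x (f i))"
  proof (intro sum.cong refl)
    fix J assume "J \<in> F"
    then show "E J = {f. f \<in> E I \<and> f ` {..<p - 1} \<subseteq> J}"
      unfolding E_def F_def by (simp add: set_eq_iff PiE_iff image_subset_iff) blast
  qed
  also have "\<dots> = (\<Sum>f\<in>E I. \<Sum>J | J \<in> F \<and> f ` {..<p - 1} \<subseteq> J. \<Prod>i<p - 1. x (f i))"
    by (rule sum.swap_restrict[OF finF finE])
  also have "\<dots> = (\<Sum>f\<in>E I. int (card {J \<in> F. f ` {..<p - 1} \<subseteq> J}) * (\<Prod>i<p - 1. x (f i)))"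
    by simp
  finally have expand: "(\<Sum>J\<in>F. sum x J ^ (p - 1)) =
      (\<Sum>f\<in>E I. int (card {J \<in> F. f ` {..<p - 1} \<subseteq> J}) * (\<Prod>i<p - 1. x (f i)))" .
  have "int p dvd (\<Sum>J\<in>F. sum x J ^ (p - 1))"
    unfolding expand
  proof (intro dvd_sum dvd_mult2)
    fix f assume f: "f \<in> E I"
    define S where "S = f ` {..<p - 1}"
    have S: "S \<subseteq> I" using f by (auto simp: S_def E_def)
    have c1: "card S \<le> p - 1" unfolding S_def using card_image_le[of "{..<p - 1}" f] by simp
    \<comment> \<open>The word \<open>f\<close> is nonempty; a monomial without variables would be counted by
      \<open>(2 p - 1) choose p\<close>, where the divisibility fails.\<close>
    have "0 \<in> {..<p - 1}" using p2 by auto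
    then have "S \<noteq> {}" unfolding S_def by blast
    then have c0: "card S \<ge> 1" unfolding S_def by (simp add: Suc_leI card_gt_0_iff)
    have "{J \<in> F. f ` {..<p - 1} \<subseteq> J} = {J. S \<subseteq> J \<and> J \<subseteq> I \<and> card J = p}"
      unfolding F_def S_def by auto
    then have "card {J \<in> F. f ` {..<p - 1} \<subseteq> J} = (2 * p - 1 - card S) choose (p - card S)"
      using card_supersets[OF I(1) S, of p] c1 I(2) by simp
    moreover have "p dvd (2 * p - 1 - card S) choose (p - card S)"
      by (rule prime_dvd_choose_above[OF p]) (use c0 c1 p2 in auto)
    ultimately show "int p dvd int (card {J \<in> F. f ` {..<p - 1} \<subseteq> J})"
      by simp
  qed
  moreover have "[(\<Sum>J\<in>F. sum x J ^ (p - 1)) = (\<Sum>J\<in>F. 1)] (mod int p)"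
  proof (rule cong_sum)
    fix J assume "J \<in> F"
    then have "\<not> int p dvd sum x J" using neg unfolding F_def by blast
    then show "[sum x J ^ (p - 1) = 1] (mod int p)" by (rule fermat_int[OF p])
  qed
  ultimately have "int p dvd (\<Sum>J\<in>F. 1)"
    using cong_dvd_iff by (metis cong_0_iff cong_sym cong_trans)
  then have "p dvd card F" by simp
  moreover have "card F = (2 * p - 1) choose p"
    unfolding F_def using n_subsets[OF I(1)] I(2) by simp
  ultimately show False using prime_not_dvd_central_choose[OF p] by simp
qed

section \<open>The Erdos-Ginzburg-Ziv theorem for products of cyclic groups\<close>

text \<open>
  For a group \<open>H\<close> with a subgroup \<open>K\<close> of index \<open>m\<close>, this is the statement of the
  Erdos-Ginzburg-Ziv theorem for the quotient \<open>H/K\<close>. Naming both \<open>H\<close> and \<open>K\<close> instead of the quotient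
  lets the property be composed along a chain of subgroups. Multisets make it possible
  to select from sums of blocks in the same way as from elements.
\<close>

definition EGZ :: "'a::comm_monoid_add set \<Rightarrow> 'a set \<Rightarrow> nat \<Rightarrow> bool" where
  "EGZ H K m \<longleftrightarrow>
     (\<forall>M. set_mset M \<subseteq> H \<and> 2 * m - 1 \<le> size M \<longrightarrow> (\<exists>N. N \<subseteq># M \<and> size N = m \<and> sum_mset N \<in> K))"

lemma EGZ_disjoint_blocks:
  assumes "EGZ H K m" "m \<ge> 1" "set_mset M \<subseteq> H" "(r + 1) * m \<le> size M + 1"
  shows "\<exists>S. sum_mset S \<subseteq># M \<and> size S = r \<and> (\<forall>N\<in>#S. size N = m \<and> sum_mset N \<in> K)"
  using assms(3,4)
proof (induction r arbitrary: M)
  case 0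
  show ?case by (rule exI[of _ "{#}"]) simp
next
  case (Suc r)
  have "2 * m \<le> (Suc r + 1) * m" by simp
  then have "2 * m - 1 \<le> size M" using Suc.prems(2) by linarith
  then obtain N where N: "N \<subseteq># M" "size N = m" "sum_mset N \<in> K"
    using assms(1) Suc.prems(1) unfolding EGZ_def by blast
  have "set_mset (M - N) \<subseteq> H" using Suc.prems(1) by (meson in_diffD subset_iff)
  moreover have "(r + 1) * m \<le> size (M - N) + 1"
    using Suc.prems(2) N by (simp add: size_Diff_submset)
  ultimately obtain S where S: "sum_mset S \<subseteq># M - N" "size S = r"
      "\<forall>N\<in>#S. size N = m \<and> sum_mset N \<in> K"
    using Suc.IH by blast
  have "N + sum_mset S \<subseteq># M"
    using N(1) S(1) by (metis subset_mset.add_diff_inverse subset_mset.add_left_mono)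
  then show ?case
    using N S by (intro exI[of _ "add_mset N S"]) auto
qed

lemma sum_mset_flatten: "sum_mset (image_mset sum_mset S) = sum_mset (sum_mset S)"
  by (induction S) auto

lemma size_sum_mset_uniform:
  fixes S :: "'a multiset multiset"
  shows "\<forall>N\<in>#S. size N = m \<Longrightarrow> size (sum_mset S) = size S * m"
  by (induction S) auto

text \<open>
  A multiset of \<open>2 m k - 1\<close> elements contains \<open>2 k - 1\<close> disjoint blocks of size \<open>m\<close> whose sums lie in
  \<open>K\<close>: after \<open>2 k - 2\<close> blocks, \<open>2 m - 1\<close> elements remain. Among the block sums there are \<open>k\<close>
  whose total lies in \<open>L\<close>, and the union of these blocks has \<open>m k\<close> elements. So the theorem for
  the two factors of a group extension implies the theorem for the extension.
\<close>

lemma EGZ_trans: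
  assumes HK: "EGZ H K m" "m \<ge> 1" and KL: "EGZ K L k" "k \<ge> 1"
  shows "EGZ H L (m * k)"
  unfolding EGZ_def
proof (intro allI impI, elim conjE)
  fix M assume M: "set_mset M \<subseteq> H" "2 * (m * k) - 1 \<le> size M"
  have "(2 * k - 1 + 1) * m = 2 * (m * k)" using KL(2) by (simp add: algebra_simps)
  then have "(2 * k - 1 + 1) * m \<le> size M + 1" using M(2) by linarith
  from EGZ_disjoint_blocks[OF HK M(1) this]
  obtain S where S: "sum_mset S \<subseteq># M" "size S = 2 * k - 1"
      "\<forall>N\<in>#S. size N = m \<and> sum_mset N \<in> K" by blast
  have "set_mset (image_mset sum_mset S) \<subseteq> K" "2 * k - 1 \<le> size (image_mset sum_mset S)"
    using S by auto
  with KL(1) obtain Q where Q: "Q \<subseteq># image_mset sum_mset S" "size Q = k" "sum_mset Q \<in> L"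
    unfolding EGZ_def by blast
  then obtain T where T: "T \<subseteq># S" "Q = image_mset sum_mset T"
    by (metis image_mset_eq_plusD mset_subset_eq_exists_conv)
  have "sum_mset T \<subseteq># M"
    using T(1) S(1) by (metis mset_subset_eq_exists_conv subset_mset.order_trans sum_mset.union)
  moreover have "\<forall>N\<in>#T. size N = m" using T(1) S(3) by (meson mset_subset_eqD)
  then have "size (sum_mset T) = m * k"
    using size_sum_mset_uniform Q(2) T(2) by (metis mult.commute size_image_mset)
  moreover have "sum_mset (sum_mset T) \<in> L" using Q(3) T(2) by (simp add: sum_mset_flatten)
  ultimately show "\<exists>N. N \<subseteq># M \<and> size N = m * k \<and> sum_mset N \<in> L" by blast
qed

text \<open>
  Used for the division by \<open>p\<close> on \<open>p\<int>\<close>, which is additive only there, and for the coordinate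
  projections; this is why additivity of \<open>f\<close> is asked on \<open>H\<close> alone.
\<close>

lemma EGZ_vimage:
  fixes f :: "'a::comm_monoid_add \<Rightarrow> 'b::comm_monoid_add"
  assumes egz: "EGZ H' K' m" and maps: "f ` H \<subseteq> H'"
    and zero: "0 \<in> H" "f 0 = 0"
    and add: "\<And>u v. u \<in> H \<Longrightarrow> v \<in> H \<Longrightarrow> u + v \<in> H \<and> f (u + v) = f u + f v"
  shows "EGZ H {v \<in> H. f v \<in> K'} m"
  unfolding EGZ_def
proof (intro allI impI, elim conjE)
  have sum: "sum_mset N \<in> H \<and> f (sum_mset N) = sum_mset (image_mset f N)"
    if "set_mset N \<subseteq> H" for N
    using that by (induction N) (auto simp: zero add)
  fix M assume M: "set_mset M \<subseteq> H" "2 * m - 1 \<le> size M"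
  then have "set_mset (image_mset f M) \<subseteq> H'" "2 * m - 1 \<le> size (image_mset f M)"
    using maps by auto
  with egz obtain Q where Q: "Q \<subseteq># image_mset f M" "size Q = m" "sum_mset Q \<in> K'"
    unfolding EGZ_def by blast
  then obtain N where N: "N \<subseteq># M" "Q = image_mset f N"
    by (metis image_mset_eq_plusD mset_subset_eq_exists_conv)
  then have "set_mset N \<subseteq> H" using M(1) set_mset_mono by blast
  then show "\<exists>N. N \<subseteq># M \<and> size N = m \<and> sum_mset N \<in> {v \<in> H. f v \<in> K'}"
    using sum N Q by (intro exI[of _ N]) auto
qed

lemma EGZ_prime:
  assumes p: "prime p"
  shows "EGZ UNIV {v. int p dvd v} p"
  unfolding EGZ_def
proof (intro allI impI, elim conjE)
  fix M :: "int multiset" assume M: "2 * p - 1 \<le> size M"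
  obtain xs where xs: "M = mset xs" by (metis ex_mset)
  have "\<exists>J\<subseteq>{..<2 * p - 1}. card J = p \<and> int p dvd (\<Sum>i\<in>J. xs ! i)"
    by (rule erdos_ginzburg_ziv_prime[OF p]) auto
  then obtain J where J: "J \<subseteq> {..<2 * p - 1}" "card J = p" "int p dvd (\<Sum>i\<in>J. xs ! i)"
    by blast
  have "J \<subseteq> {..<length xs}" using J(1) M xs by auto
  then have "mset_set J \<subseteq># mset_set {..<length xs}"
    by (simp add: msubset_mset_set_iff finite_subset)
  then have "image_mset ((!) xs) (mset_set J) \<subseteq># image_mset ((!) xs) (mset_set {..<length xs})"
    by (rule image_mset_subseteq_mono)
  also have "image_mset ((!) xs) (mset_set {..<length xs}) = M"
    by (simp add: xs lessThan_atLeast0 flip: mset_map)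
       (metis map_nth mset_map mset_upt)
  finally show "\<exists>N. N \<subseteq># M \<and> size N = p \<and> sum_mset N \<in> {v. int p dvd v}"
    using J by (intro exI[of _ "image_mset ((!) xs) (mset_set J)"]) (simp add: sum_unfold_sum_mset)
qed

lemma EGZ_one: "EGZ UNIV UNIV 1"
  unfolding EGZ_def
proof (intro allI impI, elim conjE)
  fix M :: "'a multiset" assume "2 * 1 - 1 \<le> size M"
  then obtain x where "x \<in># M" by fastforce
  then show "\<exists>N. N \<subseteq># M \<and> size N = 1 \<and> sum_mset N \<in> UNIV"
    by (intro exI[of _ "{#x#}"]) simp
qed

text \<open>
  Induction along the chain \<open>\<int> \<supseteq> p\<int> \<supseteq> p k\<int>\<close>, whose second step is the theorem for \<open>\<int>/k\<close>
  transported by division by \<open>p\<close>.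
\<close>

theorem EGZ_int: "m \<ge> 1 \<Longrightarrow> EGZ UNIV {v. int m dvd v} m"
proof (induction m rule: prime_divisors_induct)
  case (unit m)
  then show ?case using EGZ_one by simp
next
  case (factor p k)
  have pk: "p \<ge> 1" "k \<ge> 1" using factor.prems by (auto simp: Suc_le_eq)
  let ?pZ = "{v. int p dvd v}"
  have "EGZ ?pZ {v \<in> ?pZ. v div int p \<in> {v. int k dvd v}} k"
    by (rule EGZ_vimage[OF factor.IH[OF pk(2)]]) auto
  also have "{v \<in> ?pZ. v div int p \<in> {v. int k dvd v}} = {v. int (p * k) dvd v}"
    using pk(1) by (auto simp: dvd_div_iff_mult mult.commute dest: dvd_mult_left)
  finally show ?case
    using EGZ_trans[OF EGZ_prime[OF factor.hyps] pk(1) _ pk(2)] by blast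
qed simp

text \<open>
  Here the chain of subgroups imposes the divisibility conditions one coordinate at a time.
\<close>

theorem EGZ_product:
  fixes d :: "nat \<Rightarrow> nat"
  assumes "\<And>i. i \<in> {1..s} \<Longrightarrow> d i \<ge> 1"
  shows "EGZ UNIV {v. \<forall>i\<in>{1..s}. int (d i) dvd v i} (\<Prod>i\<in>{1..s}. d i)"
  using assms
proof (induction s)
  case 0
  then show ?case using EGZ_one by simp
next
  case (Suc s)
  let ?K = "{v. \<forall>i\<in>{1..s}. int (d i) dvd v i}"
  have "EGZ ?K {v \<in> ?K. v (Suc s) \<in> {u. int (d (Suc s)) dvd u}} (d (Suc s))"
    by (rule EGZ_vimage[OF EGZ_int]) (use Suc.prems in auto)
  also have "{v \<in> ?K. v (Suc s) \<in> {u. int (d (Suc s)) dvd u}}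
      = {v. \<forall>i\<in>{1..Suc s}. int (d i) dvd v i}"
    by (auto simp: atLeastAtMostSuc_conv)
  finally have step: "EGZ ?K {v. \<forall>i\<in>{1..Suc s}. int (d i) dvd v i} (d (Suc s))" .
  have "(\<Prod>i\<in>{1..s}. d i) \<ge> 1" using Suc.prems by (intro prod_ge_1) auto
  then have "EGZ UNIV {v. \<forall>i\<in>{1..Suc s}. int (d i) dvd v i} ((\<Prod>i\<in>{1..s}. d i) * d (Suc s))"
    using EGZ_trans[OF Suc.IH _ step] Suc.prems by auto
  then show ?case by simp
qed

section \<open>Sums of solutions of the linear system\<close>

lemma sum_mset_apply: "(sum_mset X) i = sum_mset (image_mset (\<lambda>v. v i) X)"
  by (induction X) auto

lemma sum_mset_eq_sum_count:
  fixes f :: "'a \<Rightarrow> int"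
  assumes "finite I" "set_mset N \<subseteq> I"
  shows "sum_mset (image_mset f N) = (\<Sum>j\<in>I. f j * int (count N j))"
  using assms(2)
proof (induction N)
  case (add x N)
  have "(\<Sum>j\<in>I. f j * int (count (add_mset x N) j))
      = (\<Sum>j\<in>I. f j * int (count N j) + (if j = x then f j else 0))"
    by (intro sum.cong) (auto simp: algebra_simps)
  then show ?case
    using add assms(1) by (simp add: sum.distrib)
qed simp

lemma system_solutions_0: "system_solutions n s a d 0 = {0}"
  unfolding system_solutions_def
  by (auto simp: fun_eq_iff sum_nonneg_eq_0_iff) (metis atLeastAtMost_iff le0)

lemma system_solutions_add:
  assumes "u \<in> system_solutions n s a d t" "v \<in> system_solutions n s a d t'"
  shows "u + v \<in> system_solutions n s a d (t + t')"
  using assms unfolding system_solutions_def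
  by (auto simp: sum.distrib distrib_left distrib_right cong_0_iff)

lemma system_solutions_diff:
  assumes "u \<in> system_solutions n s a d t" "v \<in> system_solutions n s a d (t + t')" "u \<le> v"
  shows "v - u \<in> system_solutions n s a d t'"
  using assms unfolding system_solutions_def
  by (auto simp: sum_subtractf of_nat_diff le_fun_def right_diff_distrib distrib_right cong_0_iff)

text \<open>
  For \<open>t \<ge> 1\<close> the multiset of columns that encodes \<open>y\<close> has \<open>(t + 1) D \<ge> 2 D\<close> elements, enough for the
  Erdos-Ginzburg-Ziv theorem to select a part of size \<open>D\<close> with sum zero. For \<open>t = 0\<close> there is
  nothing to split.
\<close>

lemma solution_splits_off_unit:
  assumes sys: "congruence_system n s a d" and y: "y \<in> system_solutions n s a d (Suc t)"
  shows "\<exists>z\<in>system_solutions n s a d 1. \<exists>w\<in>system_solutions n s a d t. y = w + z"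
proof (cases t)
  case 0
  then show ?thesis using y by (auto simp: system_solutions_0)
next
  case (Suc t')
  define D where "D = (\<Prod>i\<in>{1..s}. nat (d i))"
  have dpos: "d i \<ge> 1" if "i \<in> {1..s}" for i
    using sys that unfolding congruence_system_def by blast
  have nat_d: "int (nat (d i)) = d i" if "i \<in> {1..s}" for i
    using dpos[OF that] by simp
  have D: "(\<Prod>i\<in>{1..s}. d i) = int D"
    unfolding D_def of_nat_prod by (intro prod.cong) (simp_all only: nat_d)
  define M where "M = (\<Sum>j\<in>{0..n}. replicate_mset (y j) j)"
  have count_M: "count M j = y j" for j
    using y unfolding M_def system_solutions_def by (auto simp: count_sum)
  have set_M: "set_mset M \<subseteq> {0..n}"
    using y count_M unfolding system_solutions_def by (auto simp: set_mset_def)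
  have size_eq: "int (size N) = (\<Sum>j\<in>{0..n}. int (count N j))" if "set_mset N \<subseteq> {0..n}" for N
    using sum_mset_eq_sum_count[OF _ that, of "\<lambda>_. 1"] by simp
  have "int (size M) = int (Suc t * D)"
    using size_eq[OF set_M] y by (simp add: count_M system_solutions_def D algebra_simps del: One_nat_def)
  then have "size M = Suc t * D" by (simp only: of_nat_eq_iff)
  then have "2 * D - 1 \<le> size M" using Suc by simp
  define col where "col = (\<lambda>j i. a i j)"
  have "EGZ UNIV {v. \<forall>i\<in>{1..s}. int (nat (d i)) dvd v i} D"
    unfolding D_def by (rule EGZ_product) (use dpos in force)
  then obtain Q where Q: "Q \<subseteq># image_mset col M" "size Q = D"
      "\<forall>i\<in>{1..s}. int (nat (d i)) dvd sum_mset Q i"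
    unfolding EGZ_def using \<open>2 * D - 1 \<le> size M\<close>
    by (metis (mono_tags, lifting) mem_Collect_eq size_image_mset subset_UNIV)
  then obtain N where N: "N \<subseteq># M" "Q = image_mset col N"
    by (metis image_mset_eq_plusD mset_subset_eq_exists_conv)
  have set_N: "set_mset N \<subseteq> {0..n}" using N(1) set_M set_mset_mono by blast
  have "sum_mset Q i = (\<Sum>j\<in>{0..n}. a i j * int (count N j))" for i
    using sum_mset_eq_sum_count[OF _ set_N, of "a i"]
    by (simp add: N(2) sum_mset_apply col_def image_mset.compositionality comp_def)
  then have cong: "d i dvd (\<Sum>j\<in>{0..n}. a i j * int (count N j))" if "i \<in> {1..s}" for i
    using Q(3) that dpos[OF that] by force
  have "(\<Sum>j\<in>{0..n}. int (count N j)) = int D"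
    using size_eq[OF set_N] Q(2) N(2) by simp
  then have z: "count N \<in> system_solutions n s a d 1"
    using cong set_N unfolding system_solutions_def
    by (auto simp: D cong_0_iff count_eq_zero_iff simp del: One_nat_def)
  have le: "count N \<le> y"
    using N(1) count_M by (auto simp: le_fun_def subseteq_mset_def)
  then have "y - count N \<in> system_solutions n s a d t"
    using system_solutions_diff[OF z _ le, of t] y by simp
  moreover have "y = (y - count N) + count N"
    using le by (auto simp: fun_eq_iff le_fun_def)
  ultimately show ?thesis using z by blast
qed

lemma sumset_Suc: "sumset (Suc t) A = {u + v |u v. u \<in> sumset t A \<and> v \<in> A}"
proof
  show "sumset (Suc t) A \<subseteq> {u + v |u v. u \<in> sumset t A \<and> v \<in> A}"
    unfolding sumset_def by force
  show "{u + v |u v. u \<in> sumset t A \<and> v \<in> A} \<subseteq> sumset (Suc t) A"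
  proof safe
    fix u v assume "u \<in> sumset t A" "v \<in> A"
    then obtain f where f: "u = (\<Sum>k<t. f k)" "\<forall>k<t. f k \<in> A" by (auto simp: sumset_def)
    then show "u + v \<in> sumset (Suc t) A"
      using \<open>v \<in> A\<close> unfolding sumset_def
      by (intro CollectI exI[of _ "f(t := v)"]) (auto simp: less_Suc_eq)
  qed
qed

lemma sumset_system_solutions:
  assumes "congruence_system n s a d"
  shows "sumset t (system_solutions n s a d 1) = system_solutions n s a d t"
proof (induction t)
  case (Suc t)
  show ?case
    unfolding sumset_Suc Suc.IH
    using solution_splits_off_unit[OF assms] system_solutions_add[of _ n s a d t _ 1]
    by fastforce
qed (simp add: system_solutions_0)

lemma sumset_image:
  assumes "f 0 = 0" "\<And>u v. f (u + v) = f u + f v"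
  shows "sumset t (f ` A) = f ` sumset t A"
proof (induction t)
  case (Suc t)
  show ?case unfolding sumset_Suc Suc.IH by (fastforce simp: image_iff assms(2))
qed (simp add: assms(1))

text \<open>
  On the solutions with a prescribed coordinate sum, coordinate \<open>0\<close> is determined by the others, so
  the projection that defines the \<open>GT\<close>-subset loses nothing.
\<close>

lemma sumset_card_GT_subset:
  assumes "congruence_system n s a d"
  shows "sumset_card (GT_subset n s a d) t = card (system_solutions n s a d t)"
proof -
  define \<pi> :: "(nat \<Rightarrow> nat) \<Rightarrow> nat \<Rightarrow> nat" where "\<pi> = (\<lambda>y. y(0 := 0))"
  have "sumset t (GT_subset n s a d) = \<pi> ` sumset t (system_solutions n s a d 1)"
    unfolding GT_subset_def \<pi>_def by (rule sumset_image) (auto simp: fun_eq_iff)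
  then have "sumset_card (GT_subset n s a d) t = card (\<pi> ` system_solutions n s a d t)"
    by (simp only: sumset_card_def sumset_system_solutions[OF assms])
  also have "inj_on \<pi> (system_solutions n s a d t)"
  proof (rule inj_onI)
    fix y z assume y: "y \<in> system_solutions n s a d t" and z: "z \<in> system_solutions n s a d t"
      and eq: "\<pi> y = \<pi> z"
    have pos: "y j = z j" if "j \<noteq> 0" for j
      using fun_cong[OF eq, of j] that by (simp add: \<pi>_def)
    have split: "(\<Sum>j\<in>{0..n}. int (x j)) = int (x 0) + (\<Sum>j\<in>{1..n}. int (x j))" for x :: "nat \<Rightarrow> nat"
      by (simp add: sum.atLeast_Suc_atMost)
    have "(\<Sum>j\<in>{0..n}. int (y j)) = (\<Sum>j\<in>{0..n}. int (z j))"
      using y z by (simp add: system_solutions_def)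
    moreover have "(\<Sum>j\<in>{1..n}. int (y j)) = (\<Sum>j\<in>{1..n}. int (z j))"
      using pos by (intro sum.cong) auto
    ultimately have "y 0 = z 0" unfolding split by simp
    then show "y = z" using pos by (metis ext)
  qed
  then have "card (\<pi> ` system_solutions n s a d t) = card (system_solutions n s a d t)"
    by (rule card_image)
  finally show ?thesis .
qed

section \<open>Counting solutions by an Ehrhart polynomial\<close>

lemma card_weak_compositions:
  "card {q::nat \<Rightarrow> nat. (\<forall>j. j \<notin> {0..n} \<longrightarrow> q j = 0) \<and> (\<Sum>j\<in>{0..n}. q j) = m} = (m + n) choose n"
    (is "card ?W = _")
proof -
  let ?L = "{l::nat list. length l = Suc n \<and> sum_list l = m}"
  have "bij_betw (\<lambda>q. map q [0..<Suc n]) ?W ?L"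
  proof (rule bij_betw_byWitness[where f' = "\<lambda>l j. if j \<le> n then l ! j else 0"])
    show "\<forall>q\<in>?W. (\<lambda>j. if j \<le> n then map q [0..<Suc n] ! j else 0) = q"
      by (auto simp: fun_eq_iff simp del: upt_Suc)
    show "\<forall>l\<in>?L. map (\<lambda>j. if j \<le> n then l ! j else 0) [0..<Suc n] = l"
      by (auto intro!: nth_equalityI simp del: upt_Suc)
    show "(\<lambda>q. map q [0..<Suc n]) ` ?W \<subseteq> ?L"
      by (auto simp: interv_sum_list_conv_sum_set_nat atLeastLessThanSuc_atLeastAtMost
          simp del: upt_Suc)
    show "(\<lambda>l j. if j \<le> n then l ! j else 0) ` ?L \<subseteq> ?W"
      by (auto simp: sum_list_sum_nth atLeastLessThanSuc_atLeastAtMost)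
  qed
  then have "card ?W = card ?L" by (rule bij_betw_same_card)
  also have "\<dots> = (m + n) choose m" using card_length_sum_list[of "Suc n" m] by simp
  also have "\<dots> = (m + n) choose n" using binomial_symmetric[of m "m + n"] by simp
  finally show ?thesis .
qed

text \<open>
  The half-open box \<open>[0, D)\<^sup>n\<^sup>+\<^sup>1\<close> is a fundamental domain for translation by \<open>D \<int>\<^sup>n\<^sup>+\<^sup>1\<close>, so a point \<open>y\<close> is
  the same as its remainder \<open>r\<close> in the box together with its quotient \<open>q\<close>. If \<open>r\<close> has coordinate
  sum \<open>k D\<close>, then \<open>q\<close> is any nonnegative vector with coordinate sum \<open>t - k\<close>. The coordinate sum of \<open>r\<close> is
  less than \<open>(n + 1) D\<close>, whence \<open>k \<le> n\<close>. If \<open>P\<close> defines a lattice, the coefficients form the \<open>h\<^sup>*\<close>-vector of the simplex.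
\<close>

lemma card_simplex_points:
  fixes P :: "(nat \<Rightarrow> nat) \<Rightarrow> bool" and D n :: nat
  assumes D: "D > 0" and periodic: "\<And>r q. P (\<lambda>j. r j + D * q j) \<longleftrightarrow> P r"
  defines "S \<equiv> \<lambda>t. {y. (\<forall>j. j \<notin> {0..n} \<longrightarrow> y j = 0) \<and> (\<Sum>j\<in>{0..n}. y j) = t * D \<and> P y}"
  shows "card (S t) = (\<Sum>k\<le>n. card {r \<in> S k. \<forall>j. r j < D} * ((t + n - k) choose n))"
proof -
  define R where "R = (\<lambda>k. {r \<in> S k. \<forall>j. r j < D})"
  define W where
    "W = (\<lambda>m. {q::nat \<Rightarrow> nat. (\<forall>j. j \<notin> {0..n} \<longrightarrow> q j = 0) \<and> (\<Sum>j\<in>{0..n}. q j) = m})"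
  have card_W: "card (W m) = (m + n) choose n" for m
    unfolding W_def by (rule card_weak_compositions)
  have fin_W: "finite (W m)" for m
    by (rule card_ge_0_finite) (simp add: card_W)
  have fin_R: "finite (R k)" for k
    by (rule finite_subset[OF _ fin_W[of "k * D"]]) (auto simp: R_def S_def W_def)
  define K where "K = {k. k \<le> n \<and> k \<le> t}"
  have "bij_betw (\<lambda>(k, r, q). \<lambda>j. r j + D * q j) (SIGMA k:K. R k \<times> W (t - k)) (S t)"
  proof (rule bij_betw_byWitness[where f' = "\<lambda>y. ((\<Sum>j\<in>{0..n}. y j mod D) div D,
      (\<lambda>j. y j mod D), (\<lambda>j. y j div D))"])
    show "\<forall>y\<in>S t. (case ((\<Sum>j\<in>{0..n}. y j mod D) div D, (\<lambda>j. y j mod D), (\<lambda>j. y j div D)) of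
        (k, r, q) \<Rightarrow> \<lambda>j. r j + D * q j) = y"
      by simp
    show "(\<lambda>(k, r, q). \<lambda>j. r j + D * q j) ` (SIGMA k:K. R k \<times> W (t - k)) \<subseteq> S t"
      by (auto simp: K_def R_def S_def W_def periodic sum.distrib
          simp flip: sum_distrib_left distrib_right)
         (metis add_mult_distrib le_add_diff_inverse mult.commute)
    show "\<forall>x\<in>SIGMA k:K. R k \<times> W (t - k).
        (\<lambda>y. ((\<Sum>j\<in>{0..n}. y j mod D) div D, (\<lambda>j. y j mod D), (\<lambda>j. y j div D)))
          ((\<lambda>(k, r, q). \<lambda>j. r j + D * q j) x) = x"
      using D by (auto simp: R_def S_def)
    show "(\<lambda>y. ((\<Sum>j\<in>{0..n}. y j mod D) div D, (\<lambda>j. y j mod D), (\<lambda>j. y j div D))) ` S t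
        \<subseteq> (SIGMA k:K. R k \<times> W (t - k))"
    proof (rule image_subsetI)
      fix y assume y: "y \<in> S t"
      define r q where "r = (\<lambda>j. y j mod D)" and "q = (\<lambda>j. y j div D)"
      have y_eq: "y = (\<lambda>j. r j + D * q j)" by (simp add: r_def q_def)
      define k where "k = (\<Sum>j\<in>{0..n}. r j) div D"
      have sum_y: "t * D = (\<Sum>j\<in>{0..n}. r j) + D * (\<Sum>j\<in>{0..n}. q j)"
        using y by (simp add: S_def y_eq sum.distrib sum_distrib_left)
      then have "D dvd (\<Sum>j\<in>{0..n}. r j)"
        by (metis dvd_add_left_iff dvd_triv_left dvd_triv_right)
      then have sum_r: "(\<Sum>j\<in>{0..n}. r j) = k * D" by (simp add: k_def)
      have "t = k + (\<Sum>j\<in>{0..n}. q j)"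
        using sum_y D by (simp add: sum_r mult.commute flip: distrib_left)
      moreover have r_less: "r j < D" for j using D by (simp add: r_def)
      have "(\<Sum>j\<in>{0..n}. r j) < (\<Sum>j\<in>{0..n}. D)"
        by (rule sum_strict_mono) (use r_less in auto)
      then have "k * D < Suc n * D" by (simp add: sum_r)
      then have "k \<le> n" by (metis less_Suc_eq_le mult_less_cancel2)
      moreover have "P r" using y periodic[of r q] unfolding S_def y_eq by simp
      moreover have "\<forall>j. j \<notin> {0..n} \<longrightarrow> r j = 0" "\<forall>j. j \<notin> {0..n} \<longrightarrow> q j = 0"
        using y by (auto simp: S_def r_def q_def)
      ultimately have "(k, r, q) \<in> (SIGMA k:K. R k \<times> W (t - k))"
        using sum_r r_less by (simp add: K_def R_def S_def W_def)
      then show "((\<Sum>j\<in>{0..n}. y j mod D) div D, (\<lambda>j. y j mod D), (\<lambda>j. y j div D))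
          \<in> (SIGMA k:K. R k \<times> W (t - k))"
        by (simp add: k_def r_def q_def)
    qed
  qed
  then have "card (S t) = card (SIGMA k:K. R k \<times> W (t - k))"
    by (simp add: bij_betw_same_card)
  also have "\<dots> = (\<Sum>k\<in>K. card (R k \<times> W (t - k)))"
    by (rule card_SigmaI) (auto simp: K_def fin_R fin_W)
  also have "\<dots> = (\<Sum>k\<in>K. card (R k) * ((t + n - k) choose n))"
    by (intro sum.cong) (auto simp: card_cartesian_product card_W K_def)
  \<comment> \<open>The terms with \<open>t < k \<le> n\<close> vanish because then \<open>t + n - k < n\<close>.\<close>
  also have "\<dots> = (\<Sum>k\<le>n. card (R k) * ((t + n - k) choose n))"
    by (rule sum.mono_neutral_left) (auto simp: K_def binomial_eq_0)
  finally show ?thesis by (simp add: R_def)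
qed

lemma binomial_poly_exists:
  "\<exists>p::'a::field_char_0 poly. \<forall>t. poly p (of_nat t) = of_nat ((t + c) choose n)"
proof -
  define p :: "'a poly" where
    "p = Polynomial.smult (inverse (fact n)) (\<Prod>i=0..<n. [:of_nat c - of_nat i, 1:])"
  have "poly p (of_nat t) = of_nat ((t + c) choose n)" for t
    by (simp add: p_def poly_prod binomial_gbinomial gbinomial_prod_rev divide_inverse
        algebra_simps)
  then show ?thesis by blast
qed

text \<open>
  Every \<open>d i\<close> divides \<open>D\<close>, so the congruences are invariant under translation by multiples of \<open>D\<close> and
  the preceding count applies. Its terms have the form \<open>(t + (n - k)) choose n\<close> with \<open>k \<le> n\<close>, where
  the subtraction does not truncate; this makes them polynomial from \<open>t = 0\<close> on.
\<close>

lemma card_system_solutions_poly: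
  assumes sys: "congruence_system n s a d"
  shows "\<exists>p::rat poly. \<forall>t. of_nat (card (system_solutions n s a d t)) = poly p (of_nat t)"
proof -
  have dpos: "d i \<ge> 1" if "i \<in> {1..s}" for i
    using sys that unfolding congruence_system_def by blast
  define D where "D = nat (\<Prod>i\<in>{1..s}. d i)"
  have "(\<Prod>i\<in>{1..s}. d i) > 0" using dpos by (intro prod_pos) force
  then have D: "D > 0" and int_D: "int D = (\<Prod>i\<in>{1..s}. d i)" by (auto simp: D_def)
  define P where "P = (\<lambda>y::nat \<Rightarrow> nat. \<forall>i\<in>{1..s}. d i dvd (\<Sum>j\<in>{0..n}. a i j * int (y j)))"
  have "P (\<lambda>j. r j + D * q j) \<longleftrightarrow> P r" for r q
  proof -
    have "d i dvd (\<Sum>j\<in>{0..n}. a i j * int (r j + D * q j))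
        \<longleftrightarrow> d i dvd (\<Sum>j\<in>{0..n}. a i j * int (r j))" if i: "i \<in> {1..s}" for i
    proof -
      have "d i dvd int D" unfolding int_D using i by (intro dvd_prodI) auto
      then have "d i dvd (\<Sum>j\<in>{0..n}. a i j * (int D * int (q j)))"
        by (intro dvd_sum) auto
      then show ?thesis
        by (simp add: distrib_left sum.distrib dvd_add_left_iff)
    qed
    then show ?thesis by (simp add: P_def)
  qed
  note count = card_simplex_points[where P = P and n = n, OF D this]
  have solutions_eq: "system_solutions n s a d t =
      {y. (\<forall>j. j \<notin> {0..n} \<longrightarrow> y j = 0) \<and> (\<Sum>j\<in>{0..n}. y j) = t * D \<and> P y}" for t
  proof -
    have "(\<Sum>j\<in>{0..n}. int (y j)) = int t * int D \<longleftrightarrow> (\<Sum>j\<in>{0..n}. y j) = t * D"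
      for y :: "nat \<Rightarrow> nat"
      by (simp only: of_nat_eq_iff flip: of_nat_sum of_nat_mult)
    then show ?thesis
      unfolding system_solutions_def P_def int_D[symmetric] cong_0_iff by simp
  qed
  have "\<forall>k. \<exists>p::rat poly. \<forall>t. poly p (of_nat t) = of_nat ((t + (n - k)) choose n)"
    using binomial_poly_exists by blast
  then obtain b :: "nat \<Rightarrow> rat poly"
    where b: "\<And>k t. poly (b k) (of_nat t) = of_nat ((t + (n - k)) choose n)"
    by metis
  define h where "h = (\<lambda>k. card {r \<in> system_solutions n s a d k. \<forall>j. r j < D})"
  have "of_nat (card (system_solutions n s a d t))
      = poly (\<Sum>k\<le>n. Polynomial.smult (of_nat (h k)) (b k)) (of_nat t)" for t
  proof -
    have "card (system_solutions n s a d t) = (\<Sum>k\<le>n. h k * ((t + n - k) choose n))"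
      unfolding h_def solutions_eq by (rule count)
    also have "\<dots> = (\<Sum>k\<le>n. h k * ((t + (n - k)) choose n))"
      by (intro sum.cong) auto
    finally show ?thesis by (simp add: poly_sum b)
  qed
  then show ?thesis by blast
qed

theorem proposition5p3:
  fixes n s :: nat and a :: "nat \<Rightarrow> nat \<Rightarrow> int" and d :: "nat \<Rightarrow> int"
  assumes "congruence_system n s a d"
  shows "phase_transition (GT_subset n s a d) \<le> n + 1"
proof -
  let ?A = "GT_subset n s a d"
  obtain p :: "rat poly" where p: "\<And>t. of_nat (sumset_card ?A t) = poly p (of_nat t)"
    using card_system_solutions_poly[OF assms] sumset_card_GT_subset[OF assms] by auto
  then have "khovanskii_poly ?A = p"
    by (intro khovanskii_poly_eqI) simp
  then have "phase_transition ?A \<le> 0"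
    unfolding phase_transition_def by (intro Least_le) (simp add: p)
  then show ?thesis by simp
qed

end
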